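(* Let $\{x_i\}_{i=1}^m$ be a unit-norm frame for $\mathbb{R}^n$, let $P:\mathbb{R}^n\to\mathbb{R}^n$ be an orthogonal projection, and let $\{a_i\}_{i=1}^m,\{b_i\}_{i=1}^m$ be real scalars. If $\{a_iPx_i\}_{i=1}^m$ and $\{b_i(I-P)x_i\}_{i=1}^m$ are Parseval frames for $P(\mathbb{R}^n)$ and $(I-P)(\mathbb{R}^n)$, respectively, then $$|a_ib_i|\le\sqrt{a_i^2+b_i^2}\quad\text{and}\quad\min(|a_i|,|b_i|)\le\sqrt{2}\quad\text{for all } i\in\{1,\dots,m\}.$$
   Context: A finite family $\{x_i\}_{i=1}^m$ in a finite-dimensional real inner product space $H$ is a frame for $H$ if there are constants $0<A\le B<\infty$ with $A\|x\|^2\le\sum_{i=1}^m|\langle x,x_i\rangle|^2\le B\|x\|^2$ for all $x\in H$; it is unit-norm if all $\|x_i\|=1$, and it is a Parseval frame for $H$ if $\sum_{i=1}^m|\langle x,x_i\rangle|^2=\|x\|^2$ for all $x\in H$. An orthogonal projection is a linear map $P$ with $P\circ P=P$ and $P^*=P$; $I$ is the identity. *)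

theory Defs
  imports "HOL-Analysis.Analysis"
begin

text \<open>
  The inner product space in which a frame lives is a linear subspace of an ambient Euclidean space,
  with the inherited inner product; the whole space is \<open>UNIV\<close>. A family of \<open>m\<close> vectors is given by
  the values of \<open>x\<close> on \<open>{1..m}\<close>; its values elsewhere are irrelevant.
\<close>

definition frame_for :: "'a::euclidean_space set \<Rightarrow> nat \<Rightarrow> (nat \<Rightarrow> 'a) \<Rightarrow> bool" where
  "frame_for H m x \<longleftrightarrow>
     subspace H \<and> (\<forall>i\<in>{1..m}. x i \<in> H) \<and>
     (\<exists>A B :: real. 0 < A \<and> A \<le> B \<and>
        (\<forall>v\<in>H. A * (norm v)\<^sup>2 \<le> (\<Sum>i=1..m. \<bar>v \<bullet> x i\<bar>\<^sup>2) \<and>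
               (\<Sum>i=1..m. \<bar>v \<bullet> x i\<bar>\<^sup>2) \<le> B * (norm v)\<^sup>2))"

definition unit_norm_frame_for :: "'a::euclidean_space set \<Rightarrow> nat \<Rightarrow> (nat \<Rightarrow> 'a) \<Rightarrow> bool" where
  "unit_norm_frame_for H m x \<longleftrightarrow> frame_for H m x \<and> (\<forall>i\<in>{1..m}. norm (x i) = 1)"

definition parseval_frame_for :: "'a::euclidean_space set \<Rightarrow> nat \<Rightarrow> (nat \<Rightarrow> 'a) \<Rightarrow> bool" where
  "parseval_frame_for H m x \<longleftrightarrow>
     subspace H \<and> (\<forall>i\<in>{1..m}. x i \<in> H) \<and>
     (\<forall>v\<in>H. (\<Sum>i=1..m. \<bar>v \<bullet> x i\<bar>\<^sup>2) = (norm v)\<^sup>2)"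

definition orthogonal_projection :: "('a::euclidean_space \<Rightarrow> 'a) \<Rightarrow> bool" where
  "orthogonal_projection P \<longleftrightarrow> linear P \<and> P \<circ> P = P \<and> adjoint P = P"

end

theory Submission
  imports Defs
begin

text \<open>
  Members of a Parseval frame have norm at most one. With \<open>p = \<parallel>P x\<^sub>i\<parallel>\<^sup>2\<close>, Pythagoras turns this into
  \<open>a\<^sub>i\<^sup>2 p \<le> 1\<close> and \<open>b\<^sub>i\<^sup>2 (1 - p) \<le> 1\<close>. Adding \<open>b\<^sub>i\<^sup>2\<close> times the first to \<open>a\<^sub>i\<^sup>2\<close> times the second
  gives the product bound; and since \<open>p\<close> and \<open>1 - p\<close> are not both below \<open>1/2\<close>, one of \<open>a\<^sub>i\<^sup>2\<close>, \<open>b\<^sub>i\<^sup>2\<close>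
  is at most \<open>2\<close>.
\<close>

text \<open>Evaluate the Parseval identity at the member \<open>x i\<close> itself and keep only the
  \<open>i\<close>-th summand: the squared norm \<open>t\<close> then satisfies t^2 \<le> t.\<close>

lemma parseval_frame_norm_le_1:
  assumes "parseval_frame_for H m x" and i: "i \<in> {1..m}"
  shows "norm (x i) \<le> 1"
proof -
  let ?t = "(norm (x i))\<^sup>2"
  have "?t\<^sup>2 = \<bar>x i \<bullet> x i\<bar>\<^sup>2"
    by (simp add: power2_norm_eq_inner)
  also have "\<dots> \<le> (\<Sum>j=1..m. \<bar>x i \<bullet> x j\<bar>\<^sup>2)"
    using i by (intro member_le_sum[where f = "\<lambda>j. \<bar>x i \<bullet> x j\<bar>\<^sup>2"]) auto
  also have "\<dots> = ?t"
    using assms unfolding parseval_frame_for_def by blast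
  finally have "?t * ?t \<le> ?t * 1"
    by (simp only: power2_eq_square[of ?t] mult_1_right)
  \<comment> \<open>Cancelling the factor \<open>?t\<close> needs it positive, so a zero vector is
    split off.\<close>
  then have "?t \<le> 1"
    using mult_left_le_imp_le[of ?t ?t 1] by (cases "?t = 0") auto
  then show ?thesis
    by (simp add: power_le_one_iff)
qed

text \<open>Self-adjointness and idempotence make \<open>P v\<close> orthogonal to
  \<open>v - P v\<close>.\<close>

lemma orthogonal_projection_pythagoras:
  assumes "orthogonal_projection P"
  shows "(norm (P v))\<^sup>2 + (norm (v - P v))\<^sup>2 = (norm v)\<^sup>2"
proof -
  have lin: "linear P" and idem: "P (P v) = P v" and adj: "adjoint P = P"
    using assms unfolding orthogonal_projection_def by (auto simp: fun_eq_iff)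
  have "P v \<bullet> P v = P v \<bullet> v"
    using adjoint_works[OF lin, of "P v" v] adj idem by (simp add: inner_commute)
  then show ?thesis
    by (simp add: power2_norm_eq_inner inner_diff inner_commute)
qed

theorem proposition5p3:
  fixes x :: "nat \<Rightarrow> real ^ 'n"
    and P :: "real ^ 'n \<Rightarrow> real ^ 'n"
    and a b :: "nat \<Rightarrow> real"
    and m :: nat
  assumes "unit_norm_frame_for UNIV m x"
    and "orthogonal_projection P"
    and "parseval_frame_for (range P) m (\<lambda>i. a i *\<^sub>R P (x i))"
    and "parseval_frame_for (range (\<lambda>v. v - P v)) m (\<lambda>i. b i *\<^sub>R (x i - P (x i)))"
  shows "\<forall>i\<in>{1..m}. \<bar>a i * b i\<bar> \<le> sqrt ((a i)\<^sup>2 + (b i)\<^sup>2) \<and> min \<bar>a i\<bar> \<bar>b i\<bar> \<le> sqrt 2"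
proof (intro ballI conjI)
  fix i assume i: "i \<in> {1..m}"
  define p where "p = (norm (P (x i)))\<^sup>2"
  define q where "q = (norm (x i - P (x i)))\<^sup>2"
  have pq: "p + q = 1"
    using orthogonal_projection_pythagoras[OF assms(2), of "x i"] assms(1) i
    by (simp add: p_def q_def unit_norm_frame_for_def)
  have "(norm (a i *\<^sub>R P (x i)))\<^sup>2 \<le> 1" "(norm (b i *\<^sub>R (x i - P (x i))))\<^sup>2 \<le> 1"
    using parseval_frame_norm_le_1[OF assms(3) i] parseval_frame_norm_le_1[OF assms(4) i]
    by (simp_all only: power_le_one norm_ge_zero)
  then have ap: "(a i)\<^sup>2 * p \<le> 1" and bq: "(b i)\<^sup>2 * q \<le> 1"
    by (simp_all add: p_def q_def power_mult_distrib)
  \<comment> \<open>The factor \<open>p + q\<close> is 1, inserted so that the product splits into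
    multiples of \<open>ap\<close> and \<open>bq\<close>.\<close>
  have "(a i * b i)\<^sup>2 = (a i)\<^sup>2 * (b i)\<^sup>2 * (p + q)"
    by (simp add: pq power_mult_distrib)
  also have "\<dots> = (b i)\<^sup>2 * ((a i)\<^sup>2 * p) + (a i)\<^sup>2 * ((b i)\<^sup>2 * q)"
    by (simp add: algebra_simps)
  also have "\<dots> \<le> (b i)\<^sup>2 * 1 + (a i)\<^sup>2 * 1"
    by (intro add_mono mult_left_mono ap bq) simp_all
  finally show "\<bar>a i * b i\<bar> \<le> sqrt ((a i)\<^sup>2 + (b i)\<^sup>2)"
    by (intro real_le_rsqrt) simp
  \<comment> \<open>Here c^2 / 2 \<le> c^2 * r \<le> 1; used with \<open>a i\<close>,
    \<open>p\<close> or with \<open>b i\<close>, \<open>q\<close>.\<close>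
  have half: "c\<^sup>2 \<le> 2" if "c\<^sup>2 * r \<le> 1" "1/2 \<le> r" for c r :: real
    using mult_left_mono[OF that(2), of "c\<^sup>2"] that(1) by simp
  have "1/2 \<le> p \<or> 1/2 \<le> q"
    using pq by linarith
  then have "(a i)\<^sup>2 \<le> 2 \<or> (b i)\<^sup>2 \<le> 2"
    using half ap bq by blast
  then have "\<bar>a i\<bar> \<le> sqrt 2 \<or> \<bar>b i\<bar> \<le> sqrt 2"
    by (auto intro: real_le_rsqrt)
  then show "min \<bar>a i\<bar> \<bar>b i\<bar> \<le> sqrt 2"
    by (simp add: min_le_iff_disj)
qed

end
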